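(* For all $x,y\in\mathbb{B}^n$, we have $$u_{\mathbb{B}^n}(x,y)\le \rho_{\mathbb{B}^n}(x,y)+2\log 2,$$ and the inequality is sharp.
   Context: $\mathbb{B}^n=\{z\in\mathbb{R}^n:|z|<1\}$, where $|\cdot|$ is the Euclidean norm. For a domain $D\subsetneq\mathbb{R}^n$ and $x\in D$, $d(x)$ denotes the Euclidean distance from $x$ to the boundary of $D$, and the Gromov hyperbolic metric $u_D$ is $$u_D(x,y)=2\log\frac{|x-y|+\max\{d(x),d(y)\}}{\sqrt{d(x)\,d(y)}},\qquad x,y\in D.$$ For $D=\mathbb{B}^n$ one has $d(x)=1-|x|$. The hyperbolic metric $\rho_{\mathbb{B}^n}$ is defined by $$\sinh\frac{\rho_{\mathbb{B}^n}(x,y)}{2}=\frac{|x-y|}{\sqrt{(1-|x|^2)(1-|y|^2)}},\qquad x,y\in\mathbb{B}^n.$$ "Sharp" means that the additive constant $2\log 2$ cannot be replaced by a smaller constant. *)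

theory Defs
  imports "HOL-Analysis.Analysis"
begin

(* The two metrics are total functions on points; their values are meaningful for x, y in D,
   where D is a domain different from the whole space, respectively in the unit ball. *)

definition bdist :: "(real ^ 'n) set \<Rightarrow> real ^ 'n \<Rightarrow> real" where
  "bdist D x = infdist x (frontier D)"

definition gromov_dist :: "(real ^ 'n) set \<Rightarrow> real ^ 'n \<Rightarrow> real ^ 'n \<Rightarrow> real" where
  "gromov_dist D x y =
     2 * ln ((norm (x - y) + max (bdist D x) (bdist D y)) / sqrt (bdist D x * bdist D y))"

(* The hyperbolic metric is defined implicitly through sinh (rho / 2); hyp_dist_iff states the
   defining equation and its unique solvability. *)
definition hyp_dist :: "real ^ 'n \<Rightarrow> real ^ 'n \<Rightarrow> real" where
  "hyp_dist x y =
     2 * arsinh (norm (x - y) / sqrt ((1 - (norm x)\<^sup>2) * (1 - (norm y)\<^sup>2)))"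

lemma hyp_dist_iff:
  "hyp_dist x y = r \<longleftrightarrow>
     sinh (r / 2) = norm (x - y) / sqrt ((1 - (norm x)\<^sup>2) * (1 - (norm y)\<^sup>2))"
proof -
  have "2 * arsinh t = r \<longleftrightarrow> sinh (r / 2) = t" for t :: real
    using arsinh_sinh_real[of "r / 2"] sinh_arsinh_real[of t] by auto
  then show ?thesis
    unfolding hyp_dist_def .
qed

end

theory Submission
  imports Defs
begin

text \<open>
  Exponentiating half of both metrics removes all logarithms. Since
  \<open>arsinh s = ln (s + sqrt (s\<^sup>2 + 1))\<close>, the common factor \<open>sqrt ((1 - \<bar>x\<bar>) (1 - \<bar>y\<bar>))\<close> cancels, and
  the difference \<open>u - \<rho>\<close> of the Gromov hyperbolic and the hyperbolic metric is exactly twice the logarithm of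
  \<open>(t + max (1 - \<bar>x\<bar>) (1 - \<bar>y\<bar>)) sqrt ((1 + \<bar>x\<bar>) (1 + \<bar>y\<bar>)) /
    (t + sqrt (t\<^sup>2 + (1 - \<bar>x\<bar>\<^sup>2) (1 - \<bar>y\<bar>\<^sup>2)))\<close>, where \<open>t = \<bar>x - y\<bar>\<close>
  (lemma \<open>gromov_minus_hyp\<close>). So the theorem says that the supremum of this quotient is 2.

  It is at most 2 because the square root in the numerator is at most 2 and the rest is at most 1:
  the reverse triangle inequality \<open>t \<ge> \<bar>\<bar>x\<bar> - \<bar>y\<bar>\<bar>\<close> bounds the radicand in the denominator
  from below by \<open>(1 - \<bar>x\<bar>\<bar>y\<bar>)\<^sup>2\<close>, and \<open>1 - \<bar>x\<bar>\<bar>y\<bar>\<close> dominates both distances to the boundary.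

  For the quotient to approach 2, both points must approach the boundary, so that the root in the
  numerator tends to 2. The two estimates for the rest must become equalities as well. The reverse
  triangle inequality suggests points on one radius, and \<open>1 - \<bar>x\<bar>\<bar>y\<bar> = (1 - \<bar>x\<bar>) + \<bar>x\<bar> (1 - \<bar>y\<bar>)\<close> shows
  that the outer point \<open>y\<close> has to be much closer to the boundary than \<open>x\<close>. Boundary distances
  \<open>e\<close> and \<open>e\<^sup>2\<close> with \<open>e \<rightarrow> 0\<close> do this (lemma \<open>exp_half_gap_tendsto_2\<close>).
\<close>

lemma bdist_unit_ball:
  fixes x :: "real ^ 'n"
  assumes "norm x < 1"
  shows "bdist (ball 0 1) x = 1 - norm x"
proof (rule antisym)
  obtain v :: "real ^ 'n" where v: "norm v = 1" "x = norm x *\<^sub>R v"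
  proof (cases "x = 0")
    case True
    obtain v :: "real ^ 'n" where "norm v = 1"
      using vector_choose_size[of 1] by auto
    with True show ?thesis by (intro that) auto
  next
    case False
    then show ?thesis by (intro that[of "sgn x"]) (auto simp: norm_sgn sgn_div_norm)
  qed
  have "x - v = (norm x - 1) *\<^sub>R v"
    using v(2) by (simp add: scaleR_left_diff_distrib)
  then have "dist x v = 1 - norm x"
    using v(1) assms by (simp add: dist_norm)
  moreover have "v \<in> sphere 0 1"
    using v(1) by simp
  ultimately show "bdist (ball 0 1) x \<le> 1 - norm x"
    unfolding bdist_def by (metis infdist_le frontier_ball zero_less_one)
  have "1 - norm x \<le> dist x z" if "z \<in> sphere 0 1" for z
    using that norm_triangle_ineq2[of z x] by (simp add: dist_norm norm_minus_commute)
  moreover have "sphere (0 :: real ^ 'n) 1 \<noteq> {}"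
    using \<open>v \<in> sphere 0 1\<close> by blast
  ultimately show "1 - norm x \<le> bdist (ball 0 1) x"
    unfolding bdist_def by (auto simp: infdist_def intro!: cINF_greatest)
qed

lemma exp_arsinh_divide_sqrt:
  fixes t q :: real
  assumes "q > 0"
  shows "exp (arsinh (t / sqrt q)) = (t + sqrt (t\<^sup>2 + q)) / sqrt q"
proof -
  have "(t / sqrt q)\<^sup>2 + 1 = (t\<^sup>2 + q) / q"
    using assms by (simp add: power_divide add_divide_distrib)
  then have "sqrt ((t / sqrt q)\<^sup>2 + 1) = sqrt (t\<^sup>2 + q) / sqrt q"
    by (simp only: real_sqrt_divide)
  moreover have "exp (arsinh (t / sqrt q)) = t / sqrt q + sqrt ((t / sqrt q)\<^sup>2 + 1)"
    using arsinh_real_aux[of "t / sqrt q"] by (simp only: arsinh_real_def exp_ln)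
  ultimately show ?thesis
    by (simp only: add_divide_distrib)
qed

text \<open>This is \<open>exp ((u x y - \<rho> x y) / 2)\<close> for points of the open unit ball.\<close>

definition exp_half_gap :: "real ^ 'n \<Rightarrow> real ^ 'n \<Rightarrow> real" where
  "exp_half_gap x y =
     (norm (x - y) + max (1 - norm x) (1 - norm y)) * sqrt ((1 + norm x) * (1 + norm y)) /
     (norm (x - y) + sqrt ((norm (x - y))\<^sup>2 + (1 - (norm x)\<^sup>2) * (1 - (norm y)\<^sup>2)))"

lemma one_minus_power2_pos: "0 \<le> a \<Longrightarrow> a < 1 \<Longrightarrow> 0 < 1 - a\<^sup>2" for a :: real
  by (simp add: abs_square_less_1)

lemma exp_half_gap_pos:
  fixes x y :: "real ^ 'n"
  assumes "norm x < 1" "norm y < 1"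
  shows "0 < exp_half_gap x y"
proof -
  have "0 < (1 - (norm x)\<^sup>2) * (1 - (norm y)\<^sup>2)"
    using assms by (intro mult_pos_pos one_minus_power2_pos) auto
  moreover have "0 < (1 + norm x) * (1 + norm y)"
    by (intro mult_pos_pos add_pos_nonneg) auto
  ultimately show ?thesis
    unfolding exp_half_gap_def using assms
    by (intro divide_pos_pos mult_pos_pos add_nonneg_pos) (auto intro: add_nonneg_pos)
qed

text \<open>
  Factoring \<open>1 - a\<^sup>2 = (1 - a) (1 + a)\<close> lets the boundary distances cancel between the two
  metrics.
\<close>

lemma gromov_minus_hyp:
  fixes x y :: "real ^ 'n"
  assumes x: "norm x < 1" and y: "norm y < 1"
  shows "gromov_dist (ball 0 1) x y - hyp_dist x y = 2 * ln (exp_half_gap x y)"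
proof -
  define t a b where "t = norm (x - y)" and "a = norm x" and "b = norm y"
  define p d where "p = (1 + a) * (1 + b)" and "d = (1 - a) * (1 - b)"
  define q where "q = (1 - a\<^sup>2) * (1 - b\<^sup>2)"
  define h where "h = t + sqrt (t\<^sup>2 + q)"
  define g where "g = t + max (1 - a) (1 - b)"
  have ab: "0 \<le> a" "a < 1" "0 \<le> b" "b < 1" "0 \<le> t"
    using x y by (auto simp: a_def b_def t_def)
  have pos: "0 < p" "0 < d" "0 < q" "0 < g"
    unfolding p_def d_def q_def g_def using ab
    by (auto intro!: mult_pos_pos one_minus_power2_pos add_nonneg_pos)
  have "0 < h"
    using ab pos by (auto simp: h_def intro!: add_nonneg_pos)
  have "q = p * d"
    by (simp add: q_def p_def d_def power2_eq_square algebra_simps)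
  have "hyp_dist x y = 2 * ln (exp (arsinh (t / sqrt q)))"
    by (simp add: hyp_dist_def q_def t_def a_def b_def)
  also have "\<dots> = 2 * ln (h / sqrt q)"
    using pos by (simp only: exp_arsinh_divide_sqrt h_def)
  finally have "hyp_dist x y = 2 * ln (h / (sqrt p * sqrt d))"
    by (simp add: \<open>q = p * d\<close> real_sqrt_mult)
  moreover have "gromov_dist (ball 0 1) x y = 2 * ln (g / sqrt d)"
    using x y by (simp add: gromov_dist_def bdist_unit_ball g_def d_def t_def a_def b_def)
  moreover have "exp_half_gap x y = g * sqrt p / h"
    by (simp add: exp_half_gap_def g_def p_def h_def q_def t_def a_def b_def)
  ultimately show ?thesis
    using pos \<open>0 < h\<close> by (simp add: ln_div ln_mult algebra_simps)
qed

text \<open>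
  The equality \<open>(\<bar>x\<bar> - \<bar>y\<bar>)\<^sup>2 + (1 - \<bar>x\<bar>\<^sup>2) (1 - \<bar>y\<bar>\<^sup>2) = (1 - \<bar>x\<bar>\<bar>y\<bar>)\<^sup>2\<close> makes the square root
  explicit once the distance is replaced by the difference of the norms.
\<close>

lemma exp_half_gap_le_2:
  fixes x y :: "real ^ 'n"
  assumes x: "norm x < 1" and y: "norm y < 1"
  shows "exp_half_gap x y \<le> 2"
proof -
  define t a b where "t = norm (x - y)" and "a = norm x" and "b = norm y"
  define r where "r = sqrt (t\<^sup>2 + (1 - a\<^sup>2) * (1 - b\<^sup>2))"
  have ab: "0 \<le> a" "a < 1" "0 \<le> b" "b < 1" "0 \<le> t"
    using x y by (auto simp: a_def b_def t_def)
  have "\<bar>a - b\<bar> \<le> t"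
    unfolding a_def b_def t_def by (rule norm_triangle_ineq3)
  then have "(a - b)\<^sup>2 \<le> t\<^sup>2"
    using abs_le_square_iff[of "a - b" t] ab by simp
  moreover have "(1 - a * b)\<^sup>2 = (a - b)\<^sup>2 + (1 - a\<^sup>2) * (1 - b\<^sup>2)"
    by (simp add: power2_eq_square algebra_simps)
  ultimately have "1 - a * b \<le> r"
    unfolding r_def by (intro real_le_rsqrt) simp
  moreover have "a * b \<le> a" "a * b \<le> b"
    using ab by (simp_all add: mult_left_le mult_left_le_one_le)
  ultimately have max_le: "t + max (1 - a) (1 - b) \<le> t + r"
    by simp
  have "(1 + a) * (1 + b) \<le> 2 * 2"
    using ab by (intro mult_mono) auto
  then have "sqrt ((1 + a) * (1 + b)) \<le> 2"
    by (intro real_le_lsqrt) auto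
  with max_le have "(t + max (1 - a) (1 - b)) * sqrt ((1 + a) * (1 + b)) \<le> (t + r) * 2"
    using ab by (intro mult_mono) auto
  moreover have "0 < t + r"
    using ab max_le by (smt (verit))
  ultimately have "(t + max (1 - a) (1 - b)) * sqrt ((1 + a) * (1 + b)) / (t + r) \<le> 2"
    by (simp add: divide_le_eq mult.commute)
  then show ?thesis
    by (simp add: exp_half_gap_def r_def t_def a_def b_def)
qed

lemma exp_half_gap_same_radius:
  fixes v :: "real ^ 'n"
  assumes v: "norm v = 1" and "0 \<le> a" "a \<le> b" "b < 1"
  shows "exp_half_gap (a *\<^sub>R v) (b *\<^sub>R v) =
           (b - a + (1 - a)) * sqrt ((1 + a) * (1 + b)) / (b - a + (1 - a * b))"
proof -
  have "norm (a *\<^sub>R v - b *\<^sub>R v) = b - a"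
    using assms by (simp flip: scaleR_left_diff_distrib)
  moreover have "(b - a)\<^sup>2 + (1 - a\<^sup>2) * (1 - b\<^sup>2) = (1 - a * b)\<^sup>2"
    by (simp add: power2_eq_square algebra_simps)
  moreover have "a * b \<le> 1"
    using assms by (intro mult_le_one) auto
  ultimately show ?thesis
    using assms by (simp add: exp_half_gap_def)
qed

text \<open>
  After cancelling \<open>e\<close>, the quotient is a continuous function of \<open>e\<close> with value 2 at \<open>e = 0\<close>.
\<close>

lemma exp_half_gap_tendsto_2:
  fixes v :: "real ^ 'n"
  assumes v: "norm v = 1"
  shows "((\<lambda>e. exp_half_gap ((1 - e) *\<^sub>R v) ((1 - e\<^sup>2) *\<^sub>R v)) \<longlongrightarrow> 2) (at_right 0)"
proof -
  define f where "f e = (2 - e) * sqrt ((2 - e) * (2 - e\<^sup>2)) / (2 - e\<^sup>2)" for e :: real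
  have "isCont f 0"
    unfolding f_def by (intro continuous_intros) auto
  moreover have "f 0 = 2"
    by (simp add: f_def)
  ultimately have "(f \<longlongrightarrow> 2) (at_right 0)"
    by (metis isCont_def filterlim_at_split)
  moreover have "\<forall>\<^sub>F e in at_right 0. f e = exp_half_gap ((1 - e) *\<^sub>R v) ((1 - e\<^sup>2) *\<^sub>R v)"
    using eventually_at_right_less eventually_at_right_real[OF zero_less_one]
  proof eventually_elim
    case (elim e)
    then have e: "0 < e" "e < 1" by auto
    then have e2: "e\<^sup>2 \<le> e" "e\<^sup>2 < 1"
      using one_minus_power2_pos[of e] by (simp_all add: power2_eq_square mult_left_le_one_le)
    have "exp_half_gap ((1 - e) *\<^sub>R v) ((1 - e\<^sup>2) *\<^sub>R v) =
        (1 - e\<^sup>2 - (1 - e) + (1 - (1 - e))) * sqrt ((1 + (1 - e)) * (1 + (1 - e\<^sup>2))) /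
        (1 - e\<^sup>2 - (1 - e) + (1 - (1 - e) * (1 - e\<^sup>2)))"
      using e e2 by (intro exp_half_gap_same_radius[OF v]) auto
    also have "1 - e\<^sup>2 - (1 - e) + (1 - (1 - e)) = e * (2 - e)"
      by (simp add: power2_eq_square algebra_simps)
    also have "1 - e\<^sup>2 - (1 - e) + (1 - (1 - e) * (1 - e\<^sup>2)) = e * (2 - e\<^sup>2)"
      by (simp add: power2_eq_square algebra_simps)
    finally show ?case
      using e by (simp add: f_def)
  qed
  ultimately show ?thesis
    by (rule Lim_transform_eventually)
qed

theorem theorem3p3:
  "(\<forall>x\<in>ball (0 :: real ^ 'n) 1. \<forall>y\<in>ball 0 1.
      gromov_dist (ball 0 1) x y \<le> hyp_dist x y + 2 * ln 2) \<and>
   (\<forall>c < 2 * ln 2. \<not> (\<forall>x\<in>ball (0 :: real ^ 'n) 1. \<forall>y\<in>ball 0 1.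
      gromov_dist (ball 0 1) x y \<le> hyp_dist x y + c))"
proof (intro conjI ballI allI impI notI)
  fix x y :: "real ^ 'n"
  assume "x \<in> ball 0 1" "y \<in> ball 0 1"
  then have xy: "norm x < 1" "norm y < 1" by auto
  have "ln (exp_half_gap x y) \<le> ln 2"
    using exp_half_gap_pos[OF xy] exp_half_gap_le_2[OF xy] by simp
  then show "gromov_dist (ball 0 1) x y \<le> hyp_dist x y + 2 * ln 2"
    using gromov_minus_hyp[OF xy] by linarith
next
  fix c :: real
  assume c: "c < 2 * ln 2"
    and bound: "\<forall>x\<in>ball (0 :: real ^ 'n) 1. \<forall>y\<in>ball 0 1.
      gromov_dist (ball 0 1) x y \<le> hyp_dist x y + c"
  obtain v :: "real ^ 'n" where v: "norm v = 1"
    using vector_choose_size[of 1] by auto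
  have "exp (c / 2) < exp (ln 2)"
    using c by (subst exp_less_cancel_iff) simp
  then have "\<forall>\<^sub>F e in at_right 0. exp (c / 2) < exp_half_gap ((1 - e) *\<^sub>R v) ((1 - e\<^sup>2) *\<^sub>R v)"
    using order_tendstoD(1)[OF exp_half_gap_tendsto_2[OF v]] by simp
  moreover have "\<forall>\<^sub>F e :: real in at_right 0. e \<in> {0<..<1}"
    by (rule eventually_at_right_real) simp
  ultimately obtain e :: real where e: "0 < e" "e < 1"
    and gap: "exp (c / 2) < exp_half_gap ((1 - e) *\<^sub>R v) ((1 - e\<^sup>2) *\<^sub>R v)"
    using eventually_happens'[OF trivial_limit_at_right_real eventually_conj]
    by (metis (no_types, lifting) greaterThanLessThan_iff)
  let ?x = "(1 - e) *\<^sub>R v" and ?y = "(1 - e\<^sup>2) *\<^sub>R v"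
  have xy: "norm ?x < 1" "norm ?y < 1"
    using e one_minus_power2_pos[of e] v by auto
  have "2 * ln (exp_half_gap ?x ?y) \<le> c"
    using bound[rule_format, of ?x ?y] xy gromov_minus_hyp[OF xy] by simp
  moreover have "c / 2 < ln (exp_half_gap ?x ?y)"
    using gap exp_half_gap_pos[OF xy] ln_less_cancel_iff[OF exp_gt_zero, of _ "c / 2"]
    by (simp only: ln_exp)
  ultimately show False by simp
qed

end
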